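(* Let $1\leqslant k<n$ be integers and let $\mathbb{Z}\Delta=\{x=(x_1,\ldots,x_n)^\top\in\mathbb{Z}^n : k \text{ divides } x_1+\cdots+x_n\}$. An element $x\in\mathbb{Z}\Delta$ is a positive real root of $\mathsf{J}_{k,n}$ of degree $\geqslant 1$ if and only if (1) $0\leqslant x_i\leqslant \deg(x)$ for all $i=1,\ldots,n$; (2) $q(x)=2$; (3) repeated application of the map $x\longmapsto s_\beta(\mathrm{dec}(x))$ preserves property (1) until it changes the sign of all entries of $x$; that is, for the sequence $x^{(0)}=x$, $x^{(i+1)}=s_\beta(\mathrm{dec}(x^{(i)}))$, there is $m\geqslant 0$ such that each of $x^{(0)},\ldots,x^{(m)}$ satisfies property (1) (with respect to its own degree), and all entries of $x^{(m+1)}$ are non-positive.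
   Context: Let $e_1,\ldots,e_n$ be the standard basis of $\mathbb{Z}^n$. Simple roots: $\alpha_i=e_{i+1}-e_i$ for $i=1,\ldots,n-1$ and $\beta=e_1+\cdots+e_k$; they form a $\mathbb{Z}$-basis of $\mathbb{Z}\Delta$. The quadratic form is $q(x)=\sum_{i=1}^n x_i^2+\frac{2-k}{k^2}\big(\sum_{i=1}^n x_i\big)^2$, with inner product $(x,y)=\frac12(q(x+y)-q(x)-q(y))$; its Gram matrix on $\beta,\alpha_1,\ldots,\alpha_{n-1}$ is the generalized Cartan matrix of the tree $\mathsf{J}_{k,n}=\mathsf{T}_{2,k,n-k-2}$ (a path $\alpha_1-\cdots-\alpha_{n-1}$ with $\beta$ attached to $\alpha_k$). The degree of $x\in\mathbb{Z}\Delta$ is the coefficient of $\beta$ when $x$ is written in the basis $\beta,\alpha_1,\ldots,\alpha_{n-1}$; equivalently $\deg(x)=(x_1+\cdots+x_n)/k$. For $i=1,\ldots,n-1$, $s_i$ swaps the $i$-th and $(i+1)$-st coordinates; $s_\beta(x)=(x_1+r,\ldots,x_k+r,x_{k+1},\ldots,x_n)^\top$ with $r=x_{k+1}+\cdots+x_n-2\deg(x)$. The Weyl group $W=W(\mathsf{J}_{k,n})$ is the group generated by $s_\beta,s_1,\ldots,s_{n-1}$ acting on $\mathbb{Z}\Delta$. The real roots are the elements of $W\beta$; a root is positive if all its coefficients in the basis $\beta,\alpha_1,\ldots,\alpha_{n-1}$ are non-negative. For $x\in\mathbb{Z}\Delta$, $\mathrm{dec}(x)$ denotes the vector obtained by permuting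 the entries of $x$ into weakly decreasing order. *)

theory Defs
  imports Complex_Main "HOL-Algebra.Bij" "HOL-Algebra.Generated_Groups" "HOL-Combinatorics.Transposition"
    "HOL-Library.Multiset"
begin

text \<open>
  A vector \<open>x\<close> of \<open>\<int>\<^sup>n\<close> is a function \<open>nat \<Rightarrow> int\<close> whose entries are
  \<open>x 1, \<dots>, x n\<close> and which vanishes outside \<open>{1..n}\<close>.  Throughout \<open>1 \<le> k < n\<close> is intended.
\<close>

definition int_vectors :: "nat \<Rightarrow> (nat \<Rightarrow> int) set" where
  "int_vectors n = {x. \<forall>i. i \<notin> {1..n} \<longrightarrow> x i = 0}"

definition root_lattice :: "nat \<Rightarrow> nat \<Rightarrow> (nat \<Rightarrow> int) set" where
  "root_lattice k n = {x \<in> int_vectors n. int k dvd (\<Sum>i=1..n. x i)}"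

definition std_basis :: "nat \<Rightarrow> nat \<Rightarrow> int" where
  "std_basis i = (\<lambda>j. if j = i then 1 else 0)"

text \<open>Index \<open>0\<close> stands for \<open>\<beta>\<close>, and index \<open>i\<close> with \<open>1 \<le> i \<le> n - 1\<close> for \<open>\<alpha>\<^sub>i\<close>.\<close>

definition simple_root :: "nat \<Rightarrow> nat \<Rightarrow> nat \<Rightarrow> int" where
  "simple_root k i = (if i = 0 then (\<lambda>j. \<Sum>l=1..k. std_basis l j)
                      else (\<lambda>j. std_basis (i + 1) j - std_basis i j))"

abbreviation beta :: "nat \<Rightarrow> nat \<Rightarrow> int" where
  "beta k \<equiv> simple_root k 0"

definition simple_combination :: "nat \<Rightarrow> nat \<Rightarrow> (nat \<Rightarrow> int) \<Rightarrow> nat \<Rightarrow> int" where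
  "simple_combination k n c = (\<lambda>j. \<Sum>i<n. c i * simple_root k i j)"

text \<open>Coefficients in the basis \<open>\<beta>, \<alpha>\<^sub>1, \<dots>, \<alpha>\<^bsub>n-1\<^esub>\<close>;
  they exist and are unique on the root lattice, see \<open>ex1_root_coeffs\<close> below.\<close>

definition root_coeffs :: "nat \<Rightarrow> nat \<Rightarrow> (nat \<Rightarrow> int) \<Rightarrow> nat \<Rightarrow> int" where
  "root_coeffs k n x = (THE c. (\<forall>i\<ge>n. c i = 0) \<and> x = simple_combination k n c)"

definition root_degree :: "nat \<Rightarrow> nat \<Rightarrow> (nat \<Rightarrow> int) \<Rightarrow> int" where
  "root_degree k n x = root_coeffs k n x 0"

definition quad_form :: "nat \<Rightarrow> nat \<Rightarrow> (nat \<Rightarrow> int) \<Rightarrow> real" where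
  "quad_form k n x = (\<Sum>i=1..n. (real_of_int (x i))\<^sup>2)
     + (2 - real k) / (real k)\<^sup>2 * (\<Sum>i=1..n. real_of_int (x i))\<^sup>2"

definition refl_alpha :: "nat \<Rightarrow> (nat \<Rightarrow> int) \<Rightarrow> nat \<Rightarrow> int" where
  "refl_alpha i x = x \<circ> transpose i (i + 1)"

definition refl_beta :: "nat \<Rightarrow> nat \<Rightarrow> (nat \<Rightarrow> int) \<Rightarrow> nat \<Rightarrow> int" where
  "refl_beta k n x = (let r = (\<Sum>i=k+1..n. x i) - 2 * root_degree k n x
     in (\<lambda>i. if i \<in> {1..k} then x i + r else x i))"

text \<open>The generators are restricted to the lattice because the elements of \<open>BijGroup\<close>
  are extensional; that they lie in its carrier is lemma \<open>weyl_generators_in_carrier\<close> below.\<close>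

definition weyl_generators :: "nat \<Rightarrow> nat \<Rightarrow> ((nat \<Rightarrow> int) \<Rightarrow> (nat \<Rightarrow> int)) set" where
  "weyl_generators k n = insert (restrict (refl_beta k n) (root_lattice k n))
     ((\<lambda>i. restrict (refl_alpha i) (root_lattice k n)) ` {1..n-1})"

definition weyl_group :: "nat \<Rightarrow> nat \<Rightarrow> ((nat \<Rightarrow> int) \<Rightarrow> (nat \<Rightarrow> int)) set" where
  "weyl_group k n = generate (BijGroup (root_lattice k n)) (weyl_generators k n)"

definition real_roots :: "nat \<Rightarrow> nat \<Rightarrow> (nat \<Rightarrow> int) set" where
  "real_roots k n = {w (beta k) | w. w \<in> weyl_group k n}"

definition positive_real_roots :: "nat \<Rightarrow> nat \<Rightarrow> (nat \<Rightarrow> int) set" where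
  "positive_real_roots k n = {x \<in> real_roots k n. \<forall>i<n. 0 \<le> root_coeffs k n x i}"

definition dec :: "nat \<Rightarrow> (nat \<Rightarrow> int) \<Rightarrow> nat \<Rightarrow> int" where
  "dec n x = (\<lambda>i. if i \<in> {1..n} then rev (sort (map x [1..<n+1])) ! (i - 1) else 0)"

definition entries_bounded_by_degree :: "nat \<Rightarrow> nat \<Rightarrow> (nat \<Rightarrow> int) \<Rightarrow> bool" where
  "entries_bounded_by_degree k n x \<longleftrightarrow> (\<forall>i\<in>{1..n}. 0 \<le> x i \<and> x i \<le> root_degree k n x)"

definition reduction_step :: "nat \<Rightarrow> nat \<Rightarrow> (nat \<Rightarrow> int) \<Rightarrow> nat \<Rightarrow> int" where
  "reduction_step k n x = refl_beta k n (dec n x)"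


lemma beta_apply: "beta k j = (if j \<in> {1..k} then 1 else 0)"
  by (simp add: simple_root_def std_basis_def)

lemma simple_combination_apply:
  assumes "1 \<le> n"
  shows "simple_combination k n c j =
    (if j \<in> {1..k} then c 0 else 0) + (if j \<in> {2..n} then c (j - 1) else 0)
      - (if j \<in> {1..n-1} then c j else 0)"
proof -
  have s: "{..<n} = insert 0 {1..n-1}" using assms by auto
  have "simple_combination k n c j
      = c 0 * beta k j + (\<Sum>i=1..n-1. c i * simple_root k i j)"
    unfolding simple_combination_def s by simp
  also have "(\<Sum>i=1..n-1. c i * simple_root k i j)
      = (\<Sum>i=1..n-1. (if i = j - 1 \<and> 1 \<le> j then c i else 0) - (if i = j then c i else 0))"
    by (rule sum.cong) (auto simp: simple_root_def std_basis_def)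
  also have "\<dots> = (\<Sum>i=1..n-1. if i = j - 1 \<and> 1 \<le> j then c i else 0)
      - (\<Sum>i=1..n-1. if i = j then c i else 0)"
    by (simp add: sum_subtractf)
  also have "(\<Sum>i=1..n-1. if i = j - 1 \<and> 1 \<le> j then c i else 0)
      = (if j \<in> {2..n} then c (j - 1) else 0)"
    using assms by (cases "1 \<le> j") (auto simp: sum.delta)
  also have "(\<Sum>i=1..n-1. if i = j then c i else 0) = (if j \<in> {1..n-1} then c j else 0)"
    by (simp add: sum.delta)
  finally show ?thesis by (simp add: beta_apply)
qed

lemma sum_tail_simple_combination:
  assumes "1 \<le> n" "k \<le> n" "j < n"
  shows "(\<Sum>i=j+1..n. simple_combination k n c i)
    = c 0 * int (k - j) + (if j = 0 then 0 else c j)"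
proof -
  have tele: "(\<Sum>i=j+1..n. (if i \<in> {2..n} then c (i - 1) else 0)
      - (if i \<in> {1..n-1} then c i else 0)) = (if j = 0 then 0 else c j)"
  proof -
    define g where "g i = (if i \<in> {1..n-1} then c i else 0)" for i
    have "(\<Sum>i=j+1..n. (if i \<in> {2..n} then c (i - 1) else 0)
        - (if i \<in> {1..n-1} then c i else 0)) = (\<Sum>i=Suc j..n. g (i - 1) - g i)"
      by (rule sum.cong) (auto simp: g_def)
    also have "\<dots> = - (\<Sum>i=Suc j..n. g i - g (i - 1))"
      by (simp add: sum_negf [symmetric])
    also have "\<dots> = g j - g n"
      using assms(3) by (subst sum_telescope'') auto
    finally show ?thesis using assms by (auto simp: g_def)
  qed
  have "(\<Sum>i=j+1..n. if i \<in> {1..k} then c 0 else 0) = (\<Sum>i\<in>{j+1..n} \<inter> {1..k}. c 0)"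
    by (rule sum.inter_restrict [symmetric]) simp
  also have "{j+1..n} \<inter> {1..k} = {j+1..k}" using assms by auto
  finally have "(\<Sum>i=j+1..n. if i \<in> {1..k} then c 0 else 0) = c 0 * int (k - j)"
    by simp
  then show ?thesis
    using tele
    by (simp only: simple_combination_apply [OF assms(1)] add_diff_eq [symmetric] sum.distrib)
qed

lemma simple_combination_in_root_lattice:
  assumes "1 \<le> k" "k < n"
  shows "simple_combination k n c \<in> root_lattice k n"
proof -
  have "simple_combination k n c \<in> int_vectors n"
    using assms by (auto simp: int_vectors_def simple_combination_apply)
  moreover have "(\<Sum>i=1..n. simple_combination k n c i) = c 0 * int k"
    using sum_tail_simple_combination [of n k 0 c] assms by simp
  ultimately show ?thesis by (simp add: root_lattice_def)
qed

lemma ex1_root_coeffs: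
  assumes "1 \<le> k" "k < n" "x \<in> root_lattice k n"
  shows "\<exists>!c. (\<forall>i\<ge>n. c i = 0) \<and> x = simple_combination k n c"
proof -
  define d where "d = (\<Sum>i=1..n. x i) div int k"
  have dk: "d * int k = (\<Sum>i=1..n. x i)"
    using assms by (simp add: d_def root_lattice_def)
  define t where "t j = (\<Sum>i=j+1..n. x i) - d * int (k - j)" for j
  define c where "c j = (if j = 0 then d else if j < n then t j else 0)" for j
  have t0: "t 0 = 0" using dk by (simp add: t_def)
  have tn: "t n = 0" using assms by (simp add: t_def)
  have step: "x j = (if j \<le> k then d else 0) + t (j - 1) - t j" if "j \<in> {1..n}" for j
  proof -
    have "(\<Sum>i=j..n. x i) = x j + (\<Sum>i=j+1..n. x i)"
      using that by (simp add: sum.atLeast_Suc_atMost)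
    moreover have "int (k - (j - 1)) = int (k - j) + (if j \<le> k then 1 else 0)"
      using that by auto
    ultimately show ?thesis using that by (simp add: t_def algebra_simps)
  qed
  have "x j = simple_combination k n c j" for j
  proof (cases "j \<in> {1..n}")
    case True
    have "simple_combination k n c j = (if j \<le> k then d else 0) + t (j - 1) - t j"
      using True assms t0 tn
      by (cases "j = 1"; cases "j = n") (auto simp: simple_combination_apply c_def)
    with step [OF True] show ?thesis by simp
  next
    case False
    then show ?thesis
      using assms by (auto simp: simple_combination_apply root_lattice_def int_vectors_def)
  qed
  then have ex: "(\<forall>i\<ge>n. c i = 0) \<and> x = simple_combination k n c"
    using assms by (auto simp: c_def)
  have uniq: "b = c" if b: "(\<forall>i\<ge>n. b i = 0) \<and> x = simple_combination k n b" for b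
  proof -
    have eq: "b 0 * int (k - j) + (if j = 0 then 0 else b j)
        = c 0 * int (k - j) + (if j = 0 then 0 else c j)" if "j < n" for j
      using sum_tail_simple_combination [of n k j b] sum_tail_simple_combination [of n k j c]
        assms b ex that by simp
    have z: "b 0 = c 0" using eq [of 0] assms by simp
    have "b j = c j" for j
      using eq [of j] z b ex by (cases "j = 0"; cases "j < n") auto
    then show ?thesis by auto
  qed
  show ?thesis using ex uniq by blast
qed

lemma simple_combination_root_coeffs:
  assumes "1 \<le> k" "k < n" "x \<in> root_lattice k n"
  shows "simple_combination k n (root_coeffs k n x) = x"
  using theI' [OF ex1_root_coeffs [OF assms]] unfolding root_coeffs_def by simp

lemma root_degree_mult:
  assumes "1 \<le> k" "k < n" "x \<in> root_lattice k n"
  shows "int k * root_degree k n x = (\<Sum>i=1..n. x i)"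
  using sum_tail_simple_combination [of n k 0 "root_coeffs k n x"]
    simple_combination_root_coeffs [OF assms] assms
  by (simp add: root_degree_def)

lemma root_degree_eq:
  assumes "1 \<le> k" "k < n" "x \<in> root_lattice k n"
  shows "root_degree k n x = (\<Sum>i=1..n. x i) div int k"
  using root_degree_mult [OF assms, symmetric] assms(1) by simp

lemma beta_in_root_lattice:
  assumes "1 \<le> k" "k < n"
  shows "beta k \<in> root_lattice k n"
proof -
  have "beta k = simple_combination k n (\<lambda>i. if i = 0 then 1 else 0)"
    using assms by (auto simp: simple_combination_apply beta_apply fun_eq_iff)
  then show ?thesis using simple_combination_in_root_lattice [OF assms] by simp
qed

lemma refl_beta_in_root_lattice:
  assumes "1 \<le> k" "k < n" "x \<in> root_lattice k n"
  shows "refl_beta k n x \<in> root_lattice k n"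
    and "root_degree k n (refl_beta k n x)
      = (\<Sum>i=k+1..n. x i) - root_degree k n x"
proof -
  define r where "r = (\<Sum>i=k+1..n. x i) - 2 * root_degree k n x"
  have eq: "refl_beta k n x i = x i + (if i \<in> {1..k} then r else 0)" for i
    by (simp add: refl_beta_def r_def Let_def)
  have "(\<Sum>i=1..n. if i \<in> {1..k} then r else 0) = (\<Sum>i\<in>{1..n} \<inter> {1..k}. r)"
    by (rule sum.inter_restrict [symmetric]) simp
  also have "{1..n} \<inter> {1..k} = {1..k}" using assms by auto
  finally have s: "(\<Sum>i=1..n. refl_beta k n x i) = int k * (root_degree k n x + r)"
    using root_degree_mult [OF assms] by (simp add: eq sum.distrib algebra_simps)
  show mem: "refl_beta k n x \<in> root_lattice k n"
    using s assms by (auto simp: root_lattice_def int_vectors_def eq)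
  show "root_degree k n (refl_beta k n x) = (\<Sum>i=k+1..n. x i) - root_degree k n x"
    using root_degree_mult [OF assms(1,2) mem] s assms(1) by (simp add: r_def)
qed

lemma refl_beta_involutive:
  assumes "1 \<le> k" "k < n" "x \<in> root_lattice k n"
  shows "refl_beta k n (refl_beta k n x) = x"
proof -
  have "(\<Sum>i=k+1..n. refl_beta k n x i) = (\<Sum>i=k+1..n. x i)"
    by (rule sum.cong) (auto simp: refl_beta_def Let_def)
  then show ?thesis
    using refl_beta_in_root_lattice(2) [OF assms]
    by (auto simp: refl_beta_def [of k n "refl_beta k n x"] Let_def fun_eq_iff)
      (auto simp: refl_beta_def Let_def)
qed

lemma refl_alpha_in_root_lattice:
  assumes "i \<in> {1..n-1}" "x \<in> root_lattice k n"
  shows "refl_alpha i x \<in> root_lattice k n"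
proof -
  have "bij_betw (transpose i (i + 1)) {1..n} {1..n}"
    by (rule bij_betwI [where g = "transpose i (i + 1)"])
      (use assms in \<open>auto simp: transpose_def\<close>)
  then have "(\<Sum>j=1..n. refl_alpha i x j) = (\<Sum>j=1..n. x j)"
    unfolding refl_alpha_def o_def by (rule sum.reindex_bij_betw)
  then show ?thesis
    using assms by (auto simp: root_lattice_def int_vectors_def refl_alpha_def transpose_def)
qed

lemma refl_alpha_involutive: "refl_alpha i (refl_alpha i x) = x"
  by (simp add: refl_alpha_def fun_eq_iff)

lemma weyl_generators_in_carrier:
  assumes "1 \<le> k" "k < n"
  shows "weyl_generators k n \<subseteq> carrier (BijGroup (root_lattice k n))"
proof -
  have inBij: "restrict f (root_lattice k n) \<in> Bij (root_lattice k n)"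
    if "\<And>x. x \<in> root_lattice k n \<Longrightarrow> f x \<in> root_lattice k n"
      and "\<And>x. x \<in> root_lattice k n \<Longrightarrow> f (f x) = x" for f
    using that by (auto simp: Bij_def intro!: bij_betwI [where g = f])
  show ?thesis
    unfolding weyl_generators_def BijGroup_def
    using assms refl_beta_in_root_lattice(1) refl_beta_involutive
      refl_alpha_in_root_lattice refl_alpha_involutive
    by (auto intro!: inBij)
qed

lemma mset_dec: "mset (map (dec n x) [1..<n+1]) = mset (map x [1..<n+1])"
proof -
  have "map (dec n x) [1..<n+1] = rev (sort (map x [1..<n+1]))"
    by (rule nth_equalityI) (simp_all add: dec_def del: upt_Suc)
  then show ?thesis by (simp del: upt_Suc mset_map)
qed

lemma dec_antimono:
  assumes "1 \<le> i" "i \<le> j" "j \<le> n"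
  shows "dec n x j \<le> dec n x i"
proof -
  have "sort (map x [1..<n+1]) ! (n - j) \<le> sort (map x [1..<n+1]) ! (n - i)"
    by (rule sorted_nth_mono) (use assms in auto)
  then show ?thesis using assms by (simp add: dec_def rev_nth)
qed

end

theory Submission
  imports Defs "HOL-Combinatorics.Permutations"
begin

text \<open>
  The crucial input is sign coherence: in simply laced type, every real root has either only
  non-negative or only non-positive coefficients in the simple roots.  Since \<open>W\<close> contains all
  permutations of the coordinates, a real root \<open>x\<close> of degree \<open>d \<ge> 1\<close> remains positive when sorted,
  and its coefficients at \<open>\<alpha>\<^sub>1\<close> and \<open>\<alpha>\<^bsub>n-1\<^esub>\<close> then give \<open>0 \<le> x\<^sub>i \<le> d\<close>.  For the sorted root \<open>y\<close>,
  \<open>q(y) = 2\<close> forces \<open>d (y, \<beta>) \<ge> 2\<close>, so \<open>s\<^sub>\<beta>\<close> lowers the degree.  If \<open>y \<noteq> \<beta>\<close> then some coefficient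
  of \<open>y\<close> at an \<open>\<alpha>\<^sub>i\<close> is positive and unchanged by \<open>s\<^sub>\<beta>\<close>, so \<open>s\<^sub>\<beta> y\<close> is again a positive root, and its
  degree is not \<open>0\<close> by a computation with \<open>q\<close>.  Hence the reduction descends to \<open>\<beta>\<close>, which is mapped
  to \<open>-\<beta>\<close>.  Conversely, a bounded vector whose reduction has no positive entry sorts to a multiple of
  \<open>\<beta>\<close>, which is \<open>\<beta>\<close> itself since \<open>q = 2\<close>; reversing the reflections exhibits \<open>x\<close> as a real root.
\<close>

section \<open>Sign coherence of roots for a simply laced diagram\<close>

definition unit_vector :: "'a \<Rightarrow> 'a \<Rightarrow> int" where
  "unit_vector i = (\<lambda>j. if j = i then 1 else 0)"

text \<open>A finite graph without loops encodes a symmetric generalized Cartan matrix whose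
  off-diagonal entries are 0 and -1.\<close>

locale simply_laced =
  fixes I :: "'a set" and adj :: "'a \<Rightarrow> 'a \<Rightarrow> bool"
  assumes finite_I: "finite I"
    and adj_sym: "adj i j \<Longrightarrow> adj j i"
    and adj_irrefl: "\<not> adj i i"
begin

text \<open>The reflection s_i in coefficients: (x, \<alpha>_i) is 2 c_i minus the sum over the
  neighbours, and subtracting this multiple of \<alpha>_i alters only the i-th coefficient.\<close>

definition simple_refl :: "'a \<Rightarrow> ('a \<Rightarrow> int) \<Rightarrow> 'a \<Rightarrow> int" where
  "simple_refl i c = c(i := (\<Sum>j | j \<in> I \<and> adj i j. c j) - c i)"

definition word_action :: "'a list \<Rightarrow> ('a \<Rightarrow> int) \<Rightarrow> 'a \<Rightarrow> int" where
  "word_action ws = foldr simple_refl ws"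

definition reflection_group :: "(('a \<Rightarrow> int) \<Rightarrow> 'a \<Rightarrow> int) set" where
  "reflection_group = word_action ` lists I"

text \<open>Length belongs to the map and not to a word, so every relation between words bounds
  lengths at once. The value is meaningful on \<open>reflection_group\<close>, where the
  \<open>LEAST\<close> ranges over a nonempty set.\<close>

definition word_length :: "(('a \<Rightarrow> int) \<Rightarrow> 'a \<Rightarrow> int) \<Rightarrow> nat" where
  "word_length f = (LEAST l. \<exists>ws\<in>lists I. length ws = l \<and> f = word_action ws)"

lemma word_action_Nil: "word_action [] = id"
  by (auto simp: word_action_def)

lemma word_action_snoc: "word_action (ws @ [i]) = word_action ws \<circ> simple_refl i"
  by (auto simp: word_action_def fun_eq_iff)

lemma simple_refl_apply_neq: "j \<noteq> i \<Longrightarrow> simple_refl i c j = c j"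
  by (simp add: simple_refl_def)

text \<open>Evaluates neighbour sums after a function update, which turns the involution,
  commutation and braid relations into linear arithmetic.\<close>

lemma sum_adj_upd:
  "(\<Sum>j | j \<in> I \<and> adj i j. if j = t then v else c j)
    = (\<Sum>j | j \<in> I \<and> adj i j. c j) + (if t \<in> I \<and> adj i t then v - c t else (0 :: int))"
proof -
  have "(\<Sum>j | j \<in> I \<and> adj i j. if j = t then v else c j)
      = (\<Sum>j | j \<in> I \<and> adj i j. c j + (if j = t then v - c t else 0))"
    by (rule sum.cong) auto
  also have "\<dots> = (\<Sum>j | j \<in> I \<and> adj i j. c j) + (\<Sum>j | j \<in> I \<and> adj i j. if j = t then v - c t else 0)"
    by (rule sum.distrib)
  finally show ?thesis using finite_I by (simp add: sum.delta)
qed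

lemma simple_refl_involutive: "simple_refl i (simple_refl i c) = c"
  by (auto simp: simple_refl_def fun_eq_iff sum_adj_upd adj_irrefl)

lemma simple_refl_commute:
  assumes "\<not> adj i t"
  shows "simple_refl i (simple_refl t c) = simple_refl t (simple_refl i c)"
proof -
  have "\<not> adj t i" using assms adj_sym by blast
  then show ?thesis
    using assms by (cases "i = t") (auto simp: simple_refl_def fun_eq_iff sum_adj_upd)
qed

lemma simple_refl_braid:
  assumes "adj i t" "i \<in> I" "t \<in> I"
  shows "simple_refl i (simple_refl t (simple_refl i c)) = simple_refl t (simple_refl i (simple_refl t c))"
proof -
  have "adj t i" "i \<noteq> t" using assms adj_sym adj_irrefl by blast+
  then show ?thesis
    using assms by (auto simp: simple_refl_def fun_eq_iff sum_adj_upd adj_irrefl)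
qed

lemma simple_refl_add: "simple_refl i (\<lambda>j. c j + d j) = (\<lambda>j. simple_refl i c j + simple_refl i d j)"
  by (auto simp: simple_refl_def fun_eq_iff sum.distrib)

lemma simple_refl_minus: "simple_refl i (\<lambda>j. - c j) = (\<lambda>j. - simple_refl i c j)"
  by (auto simp: simple_refl_def fun_eq_iff sum_negf)

lemma word_action_add: "word_action ws (\<lambda>j. c j + d j) = (\<lambda>j. word_action ws c j + word_action ws d j)"
  by (induction ws) (auto simp: word_action_def simple_refl_add)

lemma word_action_minus: "word_action ws (\<lambda>j. - c j) = (\<lambda>j. - word_action ws c j)"
  by (induction ws) (auto simp: word_action_def simple_refl_minus)

lemma reflection_group_add:
  "f \<in> reflection_group \<Longrightarrow> f (\<lambda>j. c j + d j) = (\<lambda>j. f c j + f d j)"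
  by (auto simp: reflection_group_def word_action_add)

lemma reflection_group_minus:
  "f \<in> reflection_group \<Longrightarrow> f (\<lambda>j. - c j) = (\<lambda>j. - f c j)"
  by (auto simp: reflection_group_def word_action_minus)

lemma simple_refl_unit_same: "simple_refl i (unit_vector i) = (\<lambda>j. - unit_vector i j)"
  by (auto simp: simple_refl_def unit_vector_def fun_eq_iff adj_irrefl intro!: sum.neutral)

lemma simple_refl_unit:
  assumes "i \<noteq> t" "i \<in> I"
  shows "simple_refl t (unit_vector i)
    = (\<lambda>j. unit_vector i j + (if adj t i then unit_vector t j else 0))"
  using assms finite_I by (auto simp: simple_refl_def unit_vector_def fun_eq_iff sum.delta)

lemma reflection_group_comp:
  assumes "f \<in> reflection_group" "i \<in> I"
  shows "f \<circ> simple_refl i \<in> reflection_group"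
proof -
  obtain ws where "ws \<in> lists I" "f = word_action ws" using assms by (auto simp: reflection_group_def)
  then show ?thesis
    using assms unfolding reflection_group_def
    by (intro image_eqI [of _ _ "ws @ [i]"]) (auto simp: word_action_snoc)
qed

lemma reflection_group_reduced:
  assumes "f \<in> reflection_group"
  obtains ws where "ws \<in> lists I" "length ws = word_length f" "f = word_action ws"
proof -
  have "\<exists>l. \<exists>ws\<in>lists I. length ws = l \<and> f = word_action ws"
    using assms by (auto simp: reflection_group_def)
  from LeastI_ex [OF this] show ?thesis
    using that unfolding word_length_def by blast
qed

lemma word_length_le: "ws \<in> lists I \<Longrightarrow> word_length (word_action ws) \<le> length ws"
  unfolding word_length_def by (rule Least_le) blast

lemma word_length_comp:
  assumes "f \<in> reflection_group" "i \<in> I"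
  shows "word_length (f \<circ> simple_refl i) \<le> Suc (word_length f)"
proof -
  obtain ws where ws: "ws \<in> lists I" "length ws = word_length f" "f = word_action ws"
    using reflection_group_reduced [OF assms(1)] .
  show ?thesis
    using word_length_le [of "ws @ [i]"] ws assms by (simp add: word_action_snoc)
qed

text \<open>The last letter of a shortest word is a descent: multiplying by it once more on the
  right cancels it.\<close>

lemma word_length_descent:
  assumes "f \<in> reflection_group"
  shows "f = id \<or> (\<exists>t\<in>I. word_length (f \<circ> simple_refl t) < word_length f)"
proof -
  obtain ws where ws: "ws \<in> lists I" "length ws = word_length f" "f = word_action ws"
    using reflection_group_reduced [OF assms] .
  show ?thesis
  proof (cases ws rule: rev_cases)
    case Nil
    then show ?thesis using ws by (simp add: word_action_Nil)
  next
    case (snoc vs t)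
    have "f \<circ> simple_refl t = word_action vs"
      using ws snoc by (simp add: word_action_snoc fun_eq_iff simple_refl_involutive)
    moreover have "word_length (word_action vs) \<le> length vs"
      using ws snoc by (intro word_length_le) auto
    ultimately have "word_length (f \<circ> simple_refl t) < word_length f"
      using ws(2) snoc by simp
    then show ?thesis using ws(1) snoc by auto
  qed
qed

text \<open>Induction on the length of \<open>f\<close>: choose a descent \<open>t\<close> of \<open>f\<close> and compare \<open>f s\<^sub>i\<close> with
  shorter elements, using that \<open>s\<^sub>i\<close> and \<open>s\<^sub>t\<close> generate a group of type \<open>A\<^sub>1 \<times> A\<^sub>1\<close> or \<open>A\<^sub>2\<close>.\<close>

lemma ascent_imp_nonneg:
  assumes "f \<in> reflection_group" "i \<in> I" "word_length f \<le> word_length (f \<circ> simple_refl i)"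
  shows "0 \<le> f (unit_vector i) j"
  using assms
proof (induction "word_length f" arbitrary: f i rule: less_induct)
  case less
  note f = less.prems(1) and i = less.prems(2) and asc = less.prems(3)
  consider "f = id" | t where "t \<in> I" "word_length (f \<circ> simple_refl t) < word_length f"
    using word_length_descent [OF f] by blast
  then show ?case
  proof cases
    case 1
    then show ?thesis by (simp add: unit_vector_def)
  next
    case (2 t)
    define g where "g = f \<circ> simple_refl t"
    have g: "g \<in> reflection_group" unfolding g_def by (rule reflection_group_comp [OF f 2(1)])
    have gf: "f c = g (simple_refl t c)" for c by (simp add: g_def simple_refl_involutive)
    have ff: "g \<circ> simple_refl t = f" by (simp add: gf fun_eq_iff simple_refl_involutive)
    have lg: "word_length g < word_length f" using 2 by (simp add: g_def)
    have it: "i \<noteq> t" using asc 2 by auto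
    define h where "h = g \<circ> simple_refl i"
    have h: "h \<in> reflection_group" unfolding h_def by (rule reflection_group_comp [OF g i])
    have hg: "g c = h (simple_refl i c)" for c by (simp add: h_def simple_refl_involutive)
    show ?thesis
    proof (cases "adj t i")
      case False
      \<comment> \<open>Otherwise f s_i = g s_i s_t would have length at most that of g, which is
        below that of f.\<close>
      have "word_length g \<le> word_length (g \<circ> simple_refl i)"
      proof (rule ccontr)
        assume "\<not> ?thesis"
        moreover have "f \<circ> simple_refl i = h \<circ> simple_refl t"
          using False by (auto simp: fun_eq_iff gf h_def simple_refl_commute)
        moreover have "word_length (h \<circ> simple_refl t) \<le> Suc (word_length h)"
          by (rule word_length_comp [OF h 2(1)])
        ultimately show False using asc lg by (simp add: h_def)
      qed
      then have "0 \<le> g (unit_vector i) j" by (rule less.hyps [OF lg g i])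
      then show ?thesis using False it i by (simp add: gf simple_refl_unit)
    next
      case True
      have fi: "f (unit_vector i) = (\<lambda>j. g (unit_vector i) j + g (unit_vector t) j)"
        using True it i by (simp add: gf simple_refl_unit reflection_group_add [OF g])
      show ?thesis
      proof (cases "word_length g \<le> word_length h")
        case asc_g: True
        have "0 \<le> g (unit_vector i) j"
          by (rule less.hyps [OF lg g i]) (use asc_g in \<open>simp add: h_def\<close>)
        \<comment> \<open>t is an ascent of g, since g s_t = f is longer than g.\<close>
        moreover have "0 \<le> g (unit_vector t) j"
          by (rule less.hyps [OF lg g 2(1)]) (use lg ff in simp)
        ultimately show ?thesis by (simp add: fi)
      next
        case lh: False
        \<comment> \<open>Here f = h s_i s_t, where h is at least two shorter than f. If h s_t were
          shorter still, the braid relation f s_i = h s_t s_i s_t would make f s_i shorter than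
          f.\<close>
        have "word_length h \<le> word_length (h \<circ> simple_refl t)"
        proof (rule ccontr)
          assume *: "\<not> ?thesis"
          have ht: "h \<circ> simple_refl t \<in> reflection_group" by (rule reflection_group_comp [OF h 2(1)])
          have hti: "h \<circ> simple_refl t \<circ> simple_refl i \<in> reflection_group"
            by (rule reflection_group_comp [OF ht i])
          have "f \<circ> simple_refl i = h \<circ> simple_refl t \<circ> simple_refl i \<circ> simple_refl t"
          proof
            fix c
            show "(f \<circ> simple_refl i) c = (h \<circ> simple_refl t \<circ> simple_refl i \<circ> simple_refl t) c"
              using simple_refl_braid [OF True 2(1) i, of c] by (simp add: gf hg)
          qed
          moreover have "word_length (h \<circ> simple_refl t \<circ> simple_refl i \<circ> simple_refl t)
              \<le> Suc (Suc (word_length (h \<circ> simple_refl t)))"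
            using word_length_comp [OF hti 2(1)] word_length_comp [OF ht i] by simp
          ultimately show False using asc lg lh * by simp
        qed
        then have "0 \<le> h (unit_vector t) j"
          using less.hyps [OF _ h 2(1)] lh lg by simp
        \<comment> \<open>s_t sends \<alpha>_i to \<alpha>_i + \<alpha>_t, and s_i sends this sum to
          \<alpha>_t.\<close>
        moreover have "f (unit_vector i) = h (unit_vector t)"
        proof -
          have "f (unit_vector i) = h (simple_refl i (\<lambda>j. unit_vector i j + unit_vector t j))"
            using True it i by (simp add: gf hg simple_refl_unit)
          also have "simple_refl i (\<lambda>j. unit_vector i j + unit_vector t j) = unit_vector t"
            using True it i 2 adj_sym [OF True]
            by (simp add: simple_refl_add simple_refl_unit_same simple_refl_unit)
          finally show ?thesis .
        qed
        ultimately show ?thesis by simp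
      qed
    qed
  qed
qed

text \<open>If i is a descent of f, then it is an ascent of f s_i, whose value at \<alpha>_i is the
  negative of that of f.\<close>

lemma root_sign_coherent:
  assumes "f \<in> reflection_group" "i \<in> I"
  shows "(\<forall>j. 0 \<le> f (unit_vector i) j) \<or> (\<forall>j. f (unit_vector i) j \<le> 0)"
proof (cases "word_length f \<le> word_length (f \<circ> simple_refl i)")
  case True
  then show ?thesis using ascent_imp_nonneg [OF assms] by blast
next
  case False
  define g where "g = f \<circ> simple_refl i"
  have g: "g \<in> reflection_group" unfolding g_def by (rule reflection_group_comp [OF assms])
  have "g \<circ> simple_refl i = f" by (simp add: g_def fun_eq_iff simple_refl_involutive)
  then have "0 \<le> g (unit_vector i) j" for j
    using ascent_imp_nonneg [OF g assms(2)] False by (simp add: g_def)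
  moreover have "f (unit_vector i) = (\<lambda>j. - g (unit_vector i) j)"
    by (simp add: g_def simple_refl_unit_same reflection_group_minus [OF assms(1)])
  ultimately show ?thesis by auto
qed

end

section \<open>The diagram of J_{k,n} and its reflections in coordinates\<close>

definition diagram_adj :: "nat \<Rightarrow> nat \<Rightarrow> nat \<Rightarrow> bool" where
  "diagram_adj k i j \<longleftrightarrow>
    (if i = 0 then j = k else if j = 0 then i = k else j = Suc i \<or> i = Suc j)"

definition root_refl :: "nat \<Rightarrow> nat \<Rightarrow> nat \<Rightarrow> (nat \<Rightarrow> int) \<Rightarrow> nat \<Rightarrow> int" where
  "root_refl k n i = (if i = 0 then refl_beta k n else refl_alpha i)"

locale J_diagram =
  fixes k n :: nat
  assumes k_pos: "1 \<le> k" and k_less: "k < n"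
begin

sublocale simply_laced "{..<n}" "diagram_adj k"
  by unfold_locales (use k_pos in \<open>auto simp: diagram_adj_def split: if_splits\<close>)

abbreviation "L \<equiv> root_lattice k n"
abbreviation "deg \<equiv> root_degree k n"

lemma root_degree_eqI: "x \<in> L \<Longrightarrow> (\<Sum>i=1..n. x i) = int k * d \<Longrightarrow> deg x = d"
  using root_degree_mult [OF k_pos k_less, of x] k_pos by simp

text \<open>Tail sums determine the coefficients: the full sum gives \<open>c 0\<close>, and then
  the tail after j gives \<open>c j\<close>. Since \<open>c\<close> is unrestricted from n on,
  agreement holds only below n.\<close>

lemma root_coeffs_simple_combination:
  assumes "j < n"
  shows "root_coeffs k n (simple_combination k n c) j = c j"
proof -
  let ?x = "simple_combination k n c"
  have tail: "root_coeffs k n ?x 0 * int (k - j) + (if j = 0 then 0 else root_coeffs k n ?x j)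
      = c 0 * int (k - j) + (if j = 0 then 0 else c j)" if "j < n" for j
    using sum_tail_simple_combination [of n k j c]
      sum_tail_simple_combination [of n k j "root_coeffs k n ?x"]
      simple_combination_root_coeffs [OF k_pos k_less simple_combination_in_root_lattice [OF k_pos k_less], of c]
      k_less that by simp
  have "root_coeffs k n ?x 0 = c 0" using tail [of 0] k_pos k_less by simp
  then show ?thesis using tail [OF assms] by (cases "j = 0") simp_all
qed

lemma root_coeffs_eq_tail_sum:
  assumes "x \<in> L" "1 \<le> j" "j < n"
  shows "root_coeffs k n x j = (\<Sum>i=j+1..n. x i) - deg x * int (k - j)"
  using sum_tail_simple_combination [of n k j "root_coeffs k n x"]
    simple_combination_root_coeffs [OF k_pos k_less assms(1)] assms k_less
  by (simp add: root_degree_def)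

lemma sum_diagram_adj:
  assumes "i < n" "1 \<le> i"
  shows "(\<Sum>j | j \<in> {..<n} \<and> diagram_adj k i j. c j)
    = (if i = k then c 0 else 0) + (if 2 \<le> i then c (i - 1) else 0)
      + (if i + 1 < n then c (i + 1) else (0 :: int))"
proof -
  have "(\<Sum>j | j \<in> {..<n} \<and> diagram_adj k i j. c j) = (\<Sum>j<n. if diagram_adj k i j then c j else 0)"
    by (rule sum.inter_filter) simp
  \<comment> \<open>The guard \<open>2 \<le> i\<close> keeps the index \<open>i - 1 = 0\<close>,
    which stands for \<beta>, from counting as the path neighbour of \<alpha>_1.\<close>
  also have "\<dots> = (\<Sum>j<n. (if j = 0 then (if i = k then c j else 0) else 0)
      + (if j = i - 1 then (if 2 \<le> i then c j else 0) else 0) + (if j = i + 1 then c j else 0))"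
    by (rule sum.cong) (use assms in \<open>auto simp: diagram_adj_def\<close>)
  also have "\<dots> = (if i = k then c 0 else 0) + (if 2 \<le> i then c (i - 1) else 0)
      + (if i + 1 < n then c (i + 1) else 0)"
    using assms by (auto simp: sum.distrib sum.delta)
  finally show ?thesis .
qed

text \<open>The bridge between the coordinate formulas and the graph; it makes sign coherence
  available in the lattice.\<close>

lemma root_refl_simple_combination:
  assumes "i < n"
  shows "root_refl k n i (simple_combination k n c) = simple_combination k n (simple_refl i c)"
proof (cases "i = 0")
  case True
  have "deg (simple_combination k n c) = c 0"
    using k_less by (simp add: root_degree_def root_coeffs_simple_combination)
  \<comment> \<open>\<beta> vanishes beyond k and the \<alpha>'s telescope, so the shift r in
    s_\<beta> equals c_k - 2 c_0.\<close>
  moreover have "(\<Sum>i=k+1..n. simple_combination k n c i) = c k"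
    using sum_tail_simple_combination [of n k k c] k_pos k_less by simp
  ultimately have refl: "refl_beta k n (simple_combination k n c) j
      = simple_combination k n c j + (if j \<in> {1..k} then c k - 2 * c 0 else 0)" for j
    by (simp add: refl_beta_def Let_def)
  have "{j. j \<in> {..<n} \<and> diagram_adj k 0 j} = {k}"
    using k_less by (auto simp: diagram_adj_def)
  then have c': "simple_refl 0 c = c(0 := c k - c 0)" by (simp add: simple_refl_def)
  have "refl_beta k n (simple_combination k n c) j = simple_combination k n (simple_refl 0 c) j" for j
    unfolding refl c' using k_less by (simp add: simple_combination_apply)
  then show ?thesis using True by (auto simp: root_refl_def)
next
  case False
  have "refl_alpha i (simple_combination k n c) j = simple_combination k n (simple_refl i c) j" for j
  proof -
    consider "j = i" | "j = i + 1" | "j \<noteq> i" "j \<noteq> i + 1" by blast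
    then show ?thesis
    proof cases
      case 1
      then show ?thesis
        using False assms k_pos k_less
        by (auto simp: refl_alpha_def simple_combination_apply simple_refl_def sum_diagram_adj [simplified])
    next
      case 2
      then show ?thesis
        using False assms k_pos k_less
        by (auto simp: refl_alpha_def simple_combination_apply simple_refl_def sum_diagram_adj [simplified])
    next
      case 3
      then show ?thesis
        using False assms k_pos k_less
        by (auto simp: refl_alpha_def simple_combination_apply simple_refl_def transpose_def)
    qed
  qed
  then show ?thesis using False by (auto simp: root_refl_def)
qed

lemma root_refl_in_lattice: "i < n \<Longrightarrow> x \<in> L \<Longrightarrow> root_refl k n i x \<in> L"
  using refl_beta_in_root_lattice(1) [OF k_pos k_less] refl_alpha_in_root_lattice
  by (auto simp: root_refl_def)

lemma root_refl_involutive: "x \<in> L \<Longrightarrow> root_refl k n i (root_refl k n i x) = x"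
  using refl_beta_involutive [OF k_pos k_less] refl_alpha_involutive by (auto simp: root_refl_def)

section \<open>Real roots as words in the simple reflections\<close>

lemma foldr_root_refl_in_lattice:
  "ws \<in> lists {..<n} \<Longrightarrow> x \<in> L \<Longrightarrow> foldr (root_refl k n) ws x \<in> L"
  by (induction ws) (auto simp: root_refl_in_lattice)

lemma weyl_generators_eq:
  "weyl_generators k n = (\<lambda>i. restrict (root_refl k n i) L) ` {..<n}"
proof -
  have "{..<n} = insert 0 {1..n-1}" using k_less by auto
  then show ?thesis by (auto simp: weyl_generators_def root_refl_def image_iff)
qed

text \<open>Generators are involutions, so inverses contribute no new letters. Membership in
  \<open>Bij L\<close> is carried along because the product of \<open>BijGroup\<close> is
  composition only on bijections.\<close>

lemma weyl_group_word:
  assumes "w \<in> weyl_group k n"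
  shows "w \<in> Bij L \<and> (\<exists>ws\<in>lists {..<n}. \<forall>x\<in>L. w x = foldr (root_refl k n) ws x)"
  using assms unfolding weyl_group_def
proof (induction rule: generate.induct)
  case one
  have "\<forall>x\<in>L. \<one>\<^bsub>BijGroup L\<^esub> x = foldr (root_refl k n) [] x" by (simp add: BijGroup_def)
  moreover have "\<one>\<^bsub>BijGroup L\<^esub> \<in> Bij L" using id_Bij [of L] by (simp add: BijGroup_def)
  ultimately show ?case by blast
next
  case (incl h)
  then have hB: "h \<in> Bij L"
    using weyl_generators_in_carrier [OF k_pos k_less] by (auto simp: BijGroup_def)
  obtain i where i: "i < n" "h = restrict (root_refl k n i) L"
    using incl by (auto simp: weyl_generators_eq)
  have "\<forall>x\<in>L. h x = foldr (root_refl k n) [i] x" using i by simp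
  moreover have "[i] \<in> lists {..<n}" using i by simp
  ultimately show ?case using hB by blast
next
  case (inv h)
  then have hB: "h \<in> Bij L"
    using weyl_generators_in_carrier [OF k_pos k_less] by (auto simp: BijGroup_def)
  obtain i where i: "i < n" "h = restrict (root_refl k n i) L"
    using inv by (auto simp: weyl_generators_eq)
  have "inv\<^bsub>BijGroup L\<^esub> h = h"
  proof (rule group.inv_equality [OF group_BijGroup])
    show "h \<otimes>\<^bsub>BijGroup L\<^esub> h = \<one>\<^bsub>BijGroup L\<^esub>"
    proof -
      have "h (h x) = x" if "x \<in> L" for x
        using that i by (simp add: root_refl_in_lattice root_refl_involutive)
      then have "compose L h h = (\<lambda>x\<in>L. x)" by (auto simp: compose_def)
      then show ?thesis using hB by (simp add: BijGroup_def)
    qed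
  qed (use hB in \<open>auto simp: BijGroup_def\<close>)
  moreover have "\<forall>x\<in>L. h x = foldr (root_refl k n) [i] x" using i by simp
  moreover have "[i] \<in> lists {..<n}" using i by simp
  ultimately show ?case using hB by metis
next
  case (eng h1 h2)
  then obtain u v where uv: "u \<in> lists {..<n}" "\<forall>x\<in>L. h1 x = foldr (root_refl k n) u x"
    "v \<in> lists {..<n}" "\<forall>x\<in>L. h2 x = foldr (root_refl k n) v x" by blast
  then have "\<forall>x\<in>L. (h1 \<otimes>\<^bsub>BijGroup L\<^esub> h2) x = foldr (root_refl k n) (u @ v) x"
    using eng foldr_root_refl_in_lattice by (auto simp: BijGroup_def compose_def)
  moreover have "h1 \<otimes>\<^bsub>BijGroup L\<^esub> h2 \<in> Bij L"
    using eng by (auto simp: BijGroup_def compose_Bij)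
  ultimately show ?case using uv by (intro conjI bexI [of _ "u @ v"]) auto
qed

lemma weyl_image_beta_real_root: "w \<in> weyl_group k n \<Longrightarrow> w (beta k) \<in> real_roots k n"
  unfolding real_roots_def by blast

lemma beta_real_root: "beta k \<in> real_roots k n"
proof -
  have "\<one>\<^bsub>BijGroup L\<^esub> \<in> weyl_group k n" unfolding weyl_group_def by (rule generate.one)
  moreover have "\<one>\<^bsub>BijGroup L\<^esub> (beta k) = beta k"
    using beta_in_root_lattice [OF k_pos k_less] by (simp add: BijGroup_def)
  ultimately show ?thesis using weyl_image_beta_real_root by metis
qed

lemma real_root_refl:
  assumes "x \<in> real_roots k n" "i < n"
  shows "root_refl k n i x \<in> real_roots k n"
proof -
  obtain w where w: "w \<in> weyl_group k n" "x = w (beta k)" using assms by (auto simp: real_roots_def)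
  define g where "g = restrict (root_refl k n i) L"
  have gg: "g \<in> weyl_generators k n" using assms by (auto simp: weyl_generators_eq g_def)
  then have "g \<otimes>\<^bsub>BijGroup L\<^esub> w \<in> weyl_group k n"
    using w unfolding weyl_group_def by (blast intro: generate.intros)
  moreover have "(g \<otimes>\<^bsub>BijGroup L\<^esub> w) (beta k) = root_refl k n i x"
  proof -
    have "g \<in> Bij L"
      using gg weyl_generators_in_carrier [OF k_pos k_less] by (auto simp: BijGroup_def)
    moreover have wB: "w \<in> Bij L" by (rule weyl_group_word [OF w(1), THEN conjunct1])
    moreover have "x \<in> L"
      unfolding w(2) by (rule funcset_mem [OF Bij_imp_funcset [OF wB] beta_in_root_lattice [OF k_pos k_less]])
    ultimately show ?thesis
      using w beta_in_root_lattice [OF k_pos k_less] by (simp add: BijGroup_def compose_def g_def)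
  qed
  ultimately show ?thesis using weyl_image_beta_real_root by metis
qed

text \<open>Group elements act as words, so a real root arises from \<beta> one reflection at a
  time; invariants then need checking only on single reflections.\<close>

lemma real_root_induct [consumes 1, case_names beta refl]:
  assumes "x \<in> real_roots k n" "P (beta k)"
    and "\<And>x i. x \<in> L \<Longrightarrow> i < n \<Longrightarrow> P x \<Longrightarrow> P (root_refl k n i x)"
  shows "P x"
proof -
  obtain w where w: "w \<in> weyl_group k n" "x = w (beta k)" using assms by (auto simp: real_roots_def)
  obtain ws where ws: "ws \<in> lists {..<n}" "x = foldr (root_refl k n) ws (beta k)"
    using weyl_group_word [OF w(1)] w(2) beta_in_root_lattice [OF k_pos k_less] by auto
  have "P (foldr (root_refl k n) ws (beta k))"
    using ws(1)
    by (induction ws)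
      (auto intro!: assms foldr_root_refl_in_lattice beta_in_root_lattice k_pos k_less)
  then show ?thesis using ws by simp
qed

lemma real_root_in_lattice: "x \<in> real_roots k n \<Longrightarrow> x \<in> L"
  by (induction rule: real_root_induct)
    (rule beta_in_root_lattice [OF k_pos k_less], rule root_refl_in_lattice)

lemma real_root_simple_combination:
  assumes "x \<in> real_roots k n"
  shows "\<exists>ws\<in>lists {..<n}. x = simple_combination k n (word_action ws (unit_vector 0))"
  using assms
proof (induction rule: real_root_induct)
  case beta
  have "beta k = simple_combination k n (unit_vector 0)"
    using k_pos k_less by (auto simp: simple_combination_apply unit_vector_def beta_apply fun_eq_iff)
  then show ?case by (intro bexI [of _ "[]"]) (auto simp: word_action_def)
next
  case (refl x i)
  then obtain ws where ws: "ws \<in> lists {..<n}"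
    "x = simple_combination k n (word_action ws (unit_vector 0))" by blast
  have "root_refl k n i x = simple_combination k n (word_action (i # ws) (unit_vector 0))"
    by (simp add: ws(2) root_refl_simple_combination [OF refl(2)] word_action_def)
  moreover have "i # ws \<in> lists {..<n}" using ws(1) refl(2) by simp
  ultimately show ?case by blast
qed

lemma real_root_sign_coherent:
  assumes "x \<in> real_roots k n"
  shows "(\<forall>i<n. 0 \<le> root_coeffs k n x i) \<or> (\<forall>i<n. root_coeffs k n x i \<le> 0)"
proof -
  obtain ws where ws: "ws \<in> lists {..<n}"
    "x = simple_combination k n (word_action ws (unit_vector 0))"
    using real_root_simple_combination [OF assms] by blast
  have "word_action ws \<in> reflection_group" using ws by (auto simp: reflection_group_def)
  from root_sign_coherent [OF this, of 0] show ?thesis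
    using ws k_less by (auto simp: root_coeffs_simple_combination)
qed

lemma real_root_nonneg:
  assumes "x \<in> real_roots k n" "i < n" "0 < root_coeffs k n x i" "j < n"
  shows "0 \<le> root_coeffs k n x j"
  using real_root_sign_coherent [OF assms(1)]
proof
  assume "\<forall>i<n. root_coeffs k n x i \<le> 0"
  then have "root_coeffs k n x i \<le> 0" using assms(2) by blast
  then show ?thesis using assms(3) by linarith
qed (use assms(4) in blast)

section \<open>Permuting and sorting coordinates\<close>

lemma lattice_permute:
  assumes "x \<in> L" "p permutes {1..n}"
  shows "x \<circ> p \<in> L" and "deg (x \<circ> p) = deg x"
proof -
  have s: "(\<Sum>i=1..n. (x \<circ> p) i) = (\<Sum>i=1..n. x i)"
    by (rule sum.permute [OF assms(2), symmetric])
  show "x \<circ> p \<in> L"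
    using assms(1) s permutes_not_in [OF assms(2)] by (simp add: root_lattice_def int_vectors_def)
  then show "deg (x \<circ> p) = deg x"
    using root_degree_mult [OF k_pos k_less assms(1)] s by (intro root_degree_eqI) auto
qed

text \<open>The \<alpha>-reflections are the adjacent transpositions. Words in them give all
  transpositions, and these give all permutations.\<close>

lemma real_root_permute:
  assumes "x \<in> real_roots k n" "p permutes {1..n}"
  shows "x \<circ> p \<in> real_roots k n"
proof -
  have adjacent: "y \<circ> apply_adj_transps ws \<in> real_roots k n"
    if "y \<in> real_roots k n" "set ws \<subseteq> {1..<n}" for y ws
    using that
  proof (induction ws arbitrary: y)
    case (Cons i ws)
    have "y \<circ> transpose i (i + 1) \<in> real_roots k n"
      using real_root_refl [of y i] Cons.prems by (auto simp: root_refl_def refl_alpha_def)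
    from Cons.IH [OF this] show ?case using Cons.prems by (simp add: o_assoc)
  qed simp
  have transposition: "y \<circ> transpose a b \<in> real_roots k n"
    if "y \<in> real_roots k n" "a \<in> {1..n}" "b \<in> {1..n}" "a < b" for y a b
    using adjacent [of y "adj_transp_seq a b"] that
    by (simp add: adj_transp_seq_correct set_adj_transp_seq)
  have "finite {1..n}" by simp
  from this assms(2) show ?thesis
  proof (induction rule: permutes_rev_induct)
    case id
    then show ?case using assms by simp
  next
    case (swap a b p)
    have px: "x \<circ> p \<in> real_roots k n" using swap by (simp add: o_def)
    have "(x \<circ> p) \<circ> transpose a b \<in> real_roots k n"
    proof (cases "a < b")
      case True
      show ?thesis by (rule transposition [OF px swap(1,2) True])
    next
      case False
      then have "b < a" using swap by simp
      from transposition [OF px swap(2,1) this] show ?thesis by (simp only: transpose_commute)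
    qed
    then show ?case by (simp only: o_assoc)
  qed
qed

end

lemma int_le_square: "(v :: int) \<le> v\<^sup>2"
proof (cases "v \<le> 0")
  case True
  then show ?thesis using zero_le_power2 [of v] by linarith
next
  case False
  then show ?thesis using self_le_power [of v 2] by simp
qed

text \<open>Equal multisets of entries on \<open>{1..n}\<close> yield a permutation; outside, both
  vectors vanish and the permutation is the identity.\<close>

lemma dec_as_permutation:
  assumes "x \<in> int_vectors n"
  obtains p where "p permutes {1..n}" "dec n x = x \<circ> p"
proof -
  have "image_mset f (mset_set {1..n}) = mset (map f [1..<n+1])" for f :: "nat \<Rightarrow> int"
    by (simp add: atLeastLessThanSuc_atLeastAtMost del: upt_Suc)
  then have "image_mset (dec n x) (mset_set {1..n}) = image_mset x (mset_set {1..n})"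
    using mset_dec [of n x] by metis
  then obtain p where p: "p permutes {1..n}" "\<forall>i\<in>{1..n}. dec n x i = x (p i)"
    using image_mset_eq_implies_permutes [of "{1..n}" "dec n x" x] by auto
  have "dec n x i = x (p i)" for i
    using p assms by (cases "i \<in> {1..n}") (auto simp: dec_def int_vectors_def permutes_not_in)
  then show ?thesis using that [OF p(1)] by (auto simp: fun_eq_iff)
qed

section \<open>The quadratic form and its invariance\<close>

context J_diagram
begin

text \<open>On the lattice the coordinate sum is k times the degree, so the denominator of q cancels
  and q takes integer values.\<close>

definition int_form :: "(nat \<Rightarrow> int) \<Rightarrow> int" where
  "int_form x = (\<Sum>i=1..n. (x i)\<^sup>2) + (2 - int k) * (deg x)\<^sup>2"

lemma sum_split: "(\<Sum>i=1..n. f i) = (\<Sum>i=1..k. f i) + (\<Sum>i=k+1..n. f i :: int)"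
  using k_less sum.ub_add_nat [of 1 k f "n - k"] by simp

lemma quad_form_eq_int_form:
  assumes "x \<in> L"
  shows "quad_form k n x = real_of_int (int_form x)"
proof -
  have "(\<Sum>i=1..n. real_of_int (x i)) = real k * real_of_int (deg x)"
    using arg_cong [OF root_degree_mult [OF k_pos k_less assms], of real_of_int] by simp
  then show ?thesis
    using k_pos by (simp add: quad_form_def int_form_def power_mult_distrib)
qed

text \<open>The squares change by 2r(kd - T) + kr^2 and the degree goes from d to d + r. With T = r
  + 2d, the two contributions cancel.\<close>

lemma int_form_refl_beta:
  assumes "x \<in> L"
  shows "int_form (refl_beta k n x) = int_form x"
proof -
  define d where "d = deg x"
  define T where "T = (\<Sum>i=k+1..n. x i)"
  define r where "r = T - 2 * d"
  have head: "refl_beta k n x i = x i + r" if "i \<in> {1..k}" for i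
    using that by (simp add: refl_beta_def Let_def r_def T_def d_def)
  have tail: "refl_beta k n x i = x i" if "i \<in> {k+1..n}" for i
    using that by (auto simp: refl_beta_def Let_def)
  have dr: "deg (refl_beta k n x) = d + r"
    using refl_beta_in_root_lattice(2) [OF k_pos k_less assms] by (simp add: r_def T_def d_def)
  have S: "(\<Sum>i=1..k. x i) = int k * d - T"
    using root_degree_mult [OF k_pos k_less assms] sum_split [of x] unfolding T_def d_def by linarith
  have "(\<Sum>i=1..k. (refl_beta k n x i)\<^sup>2) = (\<Sum>i=1..k. (x i)\<^sup>2 + 2 * r * x i + r\<^sup>2)"
    by (rule sum.cong) (simp_all add: head power2_eq_square algebra_simps)
  also have "\<dots> = (\<Sum>i=1..k. (x i)\<^sup>2) + 2 * r * (int k * d - T) + int k * r\<^sup>2"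
    by (simp add: sum.distrib S del: One_nat_def flip: sum_distrib_left)
  finally have "(\<Sum>i=1..n. (refl_beta k n x i)\<^sup>2)
      = (\<Sum>i=1..n. (x i)\<^sup>2) + 2 * r * (int k * d - T) + int k * r\<^sup>2"
    using sum_split [of "\<lambda>i. (refl_beta k n x i)\<^sup>2"] sum_split [of "\<lambda>i. (x i)\<^sup>2"] tail by simp
  moreover have "T = r + 2 * d" by (simp add: r_def)
  ultimately show ?thesis
    unfolding int_form_def dr d_def [symmetric] by (simp add: power2_eq_square algebra_simps)
qed

lemma int_form_permute:
  assumes "x \<in> L" "p permutes {1..n}"
  shows "int_form (x \<circ> p) = int_form x"
  using lattice_permute [OF assms] sum.permute [OF assms(2), of "\<lambda>i. (x i)\<^sup>2"]
  by (simp add: int_form_def o_def)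

lemma int_form_beta: "int_form (\<lambda>j. d * beta k j) = 2 * d\<^sup>2"
proof -
  have "(\<Sum>i=1..k. d * beta k i) = int k * d" "(\<Sum>i=1..k. (d * beta k i)\<^sup>2) = int k * d\<^sup>2"
    by (simp_all add: beta_apply)
  moreover have "(\<Sum>i=k+1..n. d * beta k i) = 0" "(\<Sum>i=k+1..n. (d * beta k i)\<^sup>2) = 0"
    by (simp_all add: beta_apply)
  ultimately have s: "(\<Sum>i=1..n. d * beta k i) = int k * d" "(\<Sum>i=1..n. (d * beta k i)\<^sup>2) = int k * d\<^sup>2"
    using sum_split [of "\<lambda>i. d * beta k i"] sum_split [of "\<lambda>i. (d * beta k i)\<^sup>2"] by linarith+
  then have "(\<lambda>j. d * beta k j) \<in> L"
    using k_less by (auto simp: root_lattice_def int_vectors_def beta_apply)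
  then have "deg (\<lambda>j. d * beta k j) = d" using s by (intro root_degree_eqI)
  then show ?thesis using s by (simp add: int_form_def algebra_simps)
qed

lemma real_root_int_form: "x \<in> real_roots k n \<Longrightarrow> int_form x = 2"
proof (induction rule: real_root_induct)
  case beta
  then show ?case using int_form_beta [of 1] by simp
next
  case (refl x i)
  show ?case
  proof (cases "i = 0")
    case True
    then show ?thesis using refl by (simp add: root_refl_def int_form_refl_beta)
  next
    case False
    have "transpose i (i + 1) permutes {1..n}"
      using False refl by (intro permutes_swap_id) auto
    from int_form_permute [OF refl(1) this] show ?thesis
      using False refl(3) by (simp only: root_refl_def refl_alpha_def if_False)
  qed
qed

text \<open>q(d\<beta>) = 2d^2, so d^2 = 1, and the sign condition leaves d = 1.\<close>

lemma multiple_of_beta: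
  assumes "int_form y = 2" "0 \<le> d" "\<And>j. y j = d * beta k j"
  shows "y = beta k"
proof -
  have y: "y = (\<lambda>j. d * beta k j)" using assms by auto
  have "d\<^sup>2 = 1" using assms(1) unfolding y int_form_beta by simp
  then have "d = 1" using assms(2) by (simp add: power2_eq_1_iff)
  then show ?thesis using y by simp
qed

section \<open>Sorting and a single reduction step\<close>

lemma dec_lattice:
  assumes "x \<in> L"
  shows "dec n x \<in> L" "deg (dec n x) = deg x" "int_form (dec n x) = int_form x"
    "dec n x \<in> real_roots k n \<longleftrightarrow> x \<in> real_roots k n" "dec n x ` {1..n} = x ` {1..n}"
proof -
  obtain p where p: "p permutes {1..n}" "dec n x = x \<circ> p"
    using dec_as_permutation [of x n] assms by (auto simp: root_lattice_def)
  show "dec n x \<in> L" "deg (dec n x) = deg x" "int_form (dec n x) = int_form x"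
    using lattice_permute [OF assms p(1)] int_form_permute [OF assms p(1)] p(2) by simp_all
  have "x = dec n x \<circ> inv_into UNIV p" using p by (simp add: comp_assoc permutes_inv_o)
  then show "dec n x \<in> real_roots k n \<longleftrightarrow> x \<in> real_roots k n"
    using real_root_permute p permutes_inv [OF p(1)] by metis
  show "dec n x ` {1..n} = x ` {1..n}"
    using p permutes_image [OF p(1)] by (metis image_comp)
qed

lemma entries_bounded_dec:
  assumes "x \<in> L"
  shows "entries_bounded_by_degree k n (dec n x) \<longleftrightarrow> entries_bounded_by_degree k n x"
proof -
  have "entries_bounded_by_degree k n y \<longleftrightarrow> (\<forall>v \<in> y ` {1..n}. 0 \<le> v \<and> v \<le> deg y)" for y
    by (auto simp: entries_bounded_by_degree_def)
  then show ?thesis using dec_lattice [OF assms] by metis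
qed

lemma reduction_step_in_lattice: "x \<in> L \<Longrightarrow> reduction_step k n x \<in> L"
  by (simp add: reduction_step_def refl_beta_in_root_lattice(1) [OF k_pos k_less] dec_lattice)

text \<open>Sorting and s_\<beta> are both invertible by Weyl group elements. The descent uses one
  direction, the converse the other.\<close>

lemma reduction_step_real_root:
  assumes "x \<in> L"
  shows "reduction_step k n x \<in> real_roots k n \<longleftrightarrow> x \<in> real_roots k n"
proof -
  have "refl_beta k n y \<in> real_roots k n \<longleftrightarrow> y \<in> real_roots k n" if "y \<in> L" for y
    using real_root_refl [of _ 0] refl_beta_involutive [OF k_pos k_less that] k_less
    by (metis gr_implies_not0 neq0_conv root_refl_def)
  then show ?thesis using dec_lattice [OF assms] by (simp add: reduction_step_def)
qed

section \<open>Descent of the degree along real roots\<close>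

lemma real_root_entries_bounded:
  assumes "x \<in> real_roots k n" "1 \<le> deg x"
  shows "entries_bounded_by_degree k n x"
proof -
  define y where "y = dec n x"
  have xL: "x \<in> L" using assms by (simp add: real_root_in_lattice)
  have y: "y \<in> real_roots k n" "y \<in> L" "deg y = deg x"
    using dec_lattice [OF xL] assms by (simp_all add: y_def)
  have nn: "0 \<le> root_coeffs k n y j" if "j < n" for j
    using real_root_nonneg [OF y(1), of 0 j] that assms y k_less by (simp add: root_degree_def)
  \<comment> \<open>The tail has a single entry, and \<beta> contributes nothing because
    \<open>k - (n - 1)\<close> is 0 by k < n.\<close>
  have "root_coeffs k n y (n - 1) = y n"
    using root_coeffs_eq_tail_sum [OF y(2), of "n - 1"] k_pos k_less by simp
  then have lo: "0 \<le> y n" using nn [of "n - 1"] k_less by simp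
  have "(\<Sum>i=1..n. y i) = y 1 + (\<Sum>i=2..n. y i)"
    using k_less by (simp add: sum.atLeast_Suc_atMost numeral_2_eq_2)
  \<comment> \<open>The tail sum is kd - y_1, from which \<beta> removes (k - 1)d.\<close>
  then have "root_coeffs k n y 1 = deg y - y 1"
    using root_coeffs_eq_tail_sum [OF y(2), of 1] root_degree_mult [OF k_pos k_less y(2)] k_pos k_less
    by (simp add: numeral_2_eq_2 of_nat_diff algebra_simps)
  then have hi: "y 1 \<le> deg y" using nn [of 1] k_pos k_less by simp
  have "0 \<le> y i \<and> y i \<le> deg y" if "i \<in> {1..n}" for i
    using dec_antimono [of i n n x] dec_antimono [of 1 i n x] that lo hi by (auto simp: y_def)
  then have "entries_bounded_by_degree k n y" by (simp add: entries_bounded_by_degree_def)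
  then show ?thesis using entries_bounded_dec [OF xL] by (simp add: y_def)
qed

text \<open>The second factor is \<open>(y, \<beta>)\<close>.  With \<open>d = deg y\<close>, expand
  \<open>(d - y\<^sub>i) (y\<^sub>i - y\<^sub>k) \<ge> 0\<close> for \<open>i \<le> k\<close> and \<open>y\<^sub>i\<^sup>2 \<le> y\<^sub>k y\<^sub>i\<close> for \<open>i > k\<close>.\<close>

lemma beta_pairing_pos:
  assumes "y \<in> L" "entries_bounded_by_degree k n y" "int_form y = 2"
    and antimono: "\<And>i j. 1 \<le> i \<Longrightarrow> i \<le> j \<Longrightarrow> j \<le> n \<Longrightarrow> y j \<le> y i"
  shows "2 \<le> deg y * (2 * deg y - (\<Sum>i=k+1..n. y i))"
proof -
  define d where "d = deg y"
  define T where "T = (\<Sum>i=k+1..n. y i)"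
  have bnd: "0 \<le> y i" "y i \<le> d" if "i \<in> {1..n}" for i
    using assms that by (auto simp: entries_bounded_by_degree_def d_def)
  have S: "(\<Sum>i=1..k. y i) = int k * d - T"
    using root_degree_mult [OF k_pos k_less assms(1)] sum_split [of y] unfolding T_def d_def by linarith
  have "(\<Sum>i=1..k. (y i)\<^sup>2) \<le> (\<Sum>i=1..k. (d + y k) * y i - d * y k)"
  proof (rule sum_mono)
    fix i assume "i \<in> {1..k}"
    then have "0 \<le> (d - y i) * (y i - y k)"
      using bnd [of i] antimono [of i k] k_less by simp
    then show "(y i)\<^sup>2 \<le> (d + y k) * y i - d * y k"
      by (simp add: power2_eq_square algebra_simps)
  qed
  also have "\<dots> = (d + y k) * (int k * d - T) - int k * (d * y k)"
    by (simp add: sum_subtractf S del: One_nat_def flip: sum_distrib_left)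
  finally have head: "(\<Sum>i=1..k. (y i)\<^sup>2) \<le> (d + y k) * (int k * d - T) - int k * (d * y k)" .
  have "(\<Sum>i=k+1..n. (y i)\<^sup>2) \<le> (\<Sum>i=k+1..n. y k * y i)"
  proof (rule sum_mono)
    fix i assume "i \<in> {k+1..n}"
    then show "(y i)\<^sup>2 \<le> y k * y i"
      using bnd [of i] antimono [of k i] k_pos k_less
      by (simp add: power2_eq_square mult_right_mono)
  qed
  then have tail: "(\<Sum>i=k+1..n. (y i)\<^sup>2) \<le> y k * T"
    by (simp add: T_def flip: sum_distrib_left)
  have "2 = (\<Sum>i=1..k. (y i)\<^sup>2) + (\<Sum>i=k+1..n. (y i)\<^sup>2) + (2 - int k) * d\<^sup>2"
    using assms(3) sum_split [of "\<lambda>i. (y i)\<^sup>2"] by (simp add: int_form_def d_def)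
  then have "2 \<le> (d + y k) * (int k * d - T) - int k * (d * y k) + y k * T + (2 - int k) * d\<^sup>2"
    using head tail by linarith
  also have "\<dots> = d * (2 * d - T)" by (simp add: power2_eq_square algebra_simps)
  finally show ?thesis by (simp add: d_def T_def)
qed

lemma reduction_step_degree:
  assumes "x \<in> real_roots k n" "1 \<le> deg x" "dec n x \<noteq> beta k"
  shows "1 \<le> deg (reduction_step k n x)" "deg (reduction_step k n x) < deg x"
proof -
  define y where "y = dec n x"
  define d where "d = deg y"
  define T where "T = (\<Sum>i=k+1..n. y i)"
  define z where "z = refl_beta k n y"
  have xL: "x \<in> L" using assms by (simp add: real_root_in_lattice)
  have y: "y \<in> real_roots k n" "y \<in> L" "deg y = deg x"
    using dec_lattice [OF xL] assms by (simp_all add: y_def)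
  have z_refl: "z = root_refl k n 0 y" by (simp add: z_def root_refl_def)
  have z: "z \<in> real_roots k n" using real_root_refl [OF y(1), of 0] k_less by (simp add: z_refl)
  have dz: "deg z = T - d"
    using refl_beta_in_root_lattice(2) [OF k_pos k_less y(2)] by (simp add: z_def T_def d_def)
  have d: "1 \<le> d" using y assms by (simp add: d_def)
  have bounded: "entries_bounded_by_degree k n y"
    using real_root_entries_bounded [OF y(1)] y assms by simp
  have "2 \<le> deg y * (2 * deg y - (\<Sum>i=k+1..n. y i))"
    by (rule beta_pairing_pos [OF y(2) bounded real_root_int_form [OF y(1)]])
      (auto simp: y_def dec_antimono)
  then have pair: "2 \<le> d * (2 * d - T)" by (simp add: d_def T_def)
  then have "0 < 2 * d - T" using d by (smt (verit) mult_nonneg_nonpos)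
  then have less: "deg z < d" using dz by simp
  have nn: "0 \<le> root_coeffs k n y j" if "j < n" for j
    using real_root_nonneg [OF y(1), of 0 j] that d k_less by (simp add: root_degree_def d_def)
  have y_comb: "simple_combination k n (root_coeffs k n y) = y"
    by (rule simple_combination_root_coeffs [OF k_pos k_less y(2)])
  \<comment> \<open>Without such a coefficient, y would be a multiple of \<beta> and hence \<beta>
    itself.\<close>
  have "\<exists>i\<in>{1..<n}. root_coeffs k n y i \<noteq> 0"
  proof (rule ccontr)
    assume "\<not> ?thesis"
    then have zero: "i \<in> {1..<n} \<Longrightarrow> root_coeffs k n y i = 0" for i by blast
    have "y j = d * beta k j" for j
    proof -
      have "j \<in> {2..n} \<Longrightarrow> root_coeffs k n y (j - 1) = 0" by (rule zero) auto
      moreover have "j \<in> {1..n-1} \<Longrightarrow> root_coeffs k n y j = 0" by (rule zero) auto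
      ultimately show ?thesis
        using simple_combination_apply [of n k "root_coeffs k n y" j] y_comb k_less
        by (simp add: beta_apply d_def root_degree_def del: atLeastAtMost_iff One_nat_def)
    qed
    then have "y = beta k" using multiple_of_beta [OF real_root_int_form [OF y(1)], of d] d by simp
    then show False using assms by (simp add: y_def)
  qed
  then obtain i where i: "i \<in> {1..<n}" "0 < root_coeffs k n y i"
    using nn by (metis atLeastLessThan_iff order_le_imp_less_or_eq)
  \<comment> \<open>s_\<beta> changes only the coefficient of \<beta>, so this positive coefficient
    survives and sign coherence makes z positive.\<close>
  have "root_coeffs k n z i = root_coeffs k n y i"
    using root_refl_simple_combination [of 0 "root_coeffs k n y"] y_comb i k_less
    by (simp add: z_refl root_coeffs_simple_combination simple_refl_apply_neq)
  then have "0 \<le> root_coeffs k n z 0"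
    using real_root_nonneg [OF z, of i 0] i k_less by simp
  then have ge: "0 \<le> deg z" by (simp add: root_degree_def)
  \<comment> \<open>In degree 0, T = d and the absolute values of the entries of z sum to d + d.
    They are bounded by the squares, which sum to 2, so d = 1; but \<open>pair\<close> then reads 2
    \<le> 1.\<close>
  have "deg z \<noteq> 0"
  proof
    assume z0: "deg z = 0"
    then have T: "T = d" using dz by simp
    have S: "(\<Sum>i=1..k. y i) = int k * d - d"
      using root_degree_mult [OF k_pos k_less y(2)] sum_split [of y] T by (simp add: T_def d_def)
    have "(\<Sum>i=1..k. d - y i) \<le> (\<Sum>i=1..k. (z i)\<^sup>2)"
    proof (rule sum_mono)
      fix i assume "i \<in> {1..k}"
      then have "z i = - (d - y i)" using T by (simp add: z_def refl_beta_def Let_def T_def d_def)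
      then show "d - y i \<le> (z i)\<^sup>2"
        using int_le_square [of "d - y i"] by (simp only: power2_minus)
    qed
    moreover have "(\<Sum>i=k+1..n. y i) \<le> (\<Sum>i=k+1..n. (z i)\<^sup>2)"
    proof (rule sum_mono)
      fix i assume "i \<in> {k+1..n}"
      then have "z i = y i" by (simp add: z_def refl_beta_def Let_def)
      then show "y i \<le> (z i)\<^sup>2" by (simp add: int_le_square)
    qed
    moreover have "(\<Sum>i=1..n. (z i)\<^sup>2) = 2"
      using real_root_int_form [OF z] z0 by (simp add: int_form_def)
    ultimately have "d + d \<le> 2"
      using S T sum_split [of "\<lambda>i. (z i)\<^sup>2"] by (simp add: sum_subtractf T_def)
    then show False using pair T d by simp
  qed
  with ge show "1 \<le> deg (reduction_step k n x)" by (simp add: reduction_step_def z_def y_def)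
  show "deg (reduction_step k n x) < deg x"
    using less y by (simp add: reduction_step_def z_def y_def d_def)
qed

lemma real_root_reduction:
  assumes "x \<in> real_roots k n" "1 \<le> deg x"
  shows "\<exists>m. (\<forall>i\<le>m. entries_bounded_by_degree k n ((reduction_step k n ^^ i) x)) \<and>
    (\<forall>j\<in>{1..n}. (reduction_step k n ^^ (m + 1)) x j \<le> 0)"
  using assms
proof (induction "nat (deg x)" arbitrary: x rule: less_induct)
  case less
  have bounded: "entries_bounded_by_degree k n x"
    by (rule real_root_entries_bounded [OF less.prems])
  show ?case
  proof (cases "dec n x = beta k")
    case True
    have "deg (beta k) = 1"
      using dec_lattice(2) [of x] True less.prems beta_in_root_lattice [OF k_pos k_less]
        root_degree_eqI [of "beta k" 1] sum_split [of "beta k"] by (simp add: beta_apply)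
    \<comment> \<open>For \<beta> the shift r is -2, so the entries become -1 and 0, and m = 0
      works.\<close>
    then have "reduction_step k n x j \<le> 0" for j
      using True by (simp add: reduction_step_def refl_beta_def Let_def beta_apply)
    then show ?thesis using bounded by (intro exI [of _ 0]) simp
  next
    case False
    define y where "y = reduction_step k n x"
    have "y \<in> real_roots k n"
      using reduction_step_real_root real_root_in_lattice less.prems by (simp add: y_def)
    moreover have "1 \<le> deg y" "deg y < deg x"
      using reduction_step_degree [OF less.prems False] by (simp_all add: y_def)
    ultimately obtain m where
      m: "\<forall>i\<le>m. entries_bounded_by_degree k n ((reduction_step k n ^^ i) y)"
        "\<forall>j\<in>{1..n}. (reduction_step k n ^^ (m + 1)) y j \<le> 0"
      using less.hyps [of y] less.prems by auto
    \<comment> \<open>The run of y is the run of x without its first vector, so the witness m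
      becomes \<open>Suc m\<close>.\<close>
    have shift: "(reduction_step k n ^^ Suc i) x = (reduction_step k n ^^ i) y" for i
      by (simp add: funpow_Suc_right y_def del: funpow.simps)
    have "entries_bounded_by_degree k n ((reduction_step k n ^^ i) x)" if "i \<le> Suc m" for i
    proof (cases i)
      case 0
      then show ?thesis using bounded by simp
    next
      case (Suc i')
      then show ?thesis using m(1) that by (simp add: shift del: funpow.simps)
    qed
    moreover have "\<forall>j\<in>{1..n}. (reduction_step k n ^^ (Suc m + 1)) x j \<le> 0"
      using m(2) shift [of "Suc m"] by simp
    ultimately show ?thesis by blast
  qed
qed

section \<open>From a terminating reduction back to a real root\<close>

lemma reduction_imp_real_root:
  assumes "x \<in> L" "int_form x = 2"
    and "\<forall>i\<le>m. entries_bounded_by_degree k n ((reduction_step k n ^^ i) x)"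
    and "\<forall>j\<in>{1..n}. (reduction_step k n ^^ (m + 1)) x j \<le> 0"
  shows "x \<in> real_roots k n"
  using assms
proof (induction m arbitrary: x)
  case 0
  define y where "y = dec n x"
  have y: "y \<in> L" "int_form y = 2" "entries_bounded_by_degree k n y"
    using 0 dec_lattice entries_bounded_dec by (simp_all add: y_def)
  have nonpos: "refl_beta k n y j \<le> 0" if "j \<in> {1..n}" for j
    using 0 that by (simp add: reduction_step_def y_def)
  \<comment> \<open>s_\<beta> leaves these entries alone: they are non-negative before the step and
    non-positive after it.\<close>
  have tail: "y j = 0" if "j \<in> {k+1..n}" for j
  proof -
    have "refl_beta k n y j = y j" using that by (simp add: refl_beta_def Let_def)
    moreover have "0 \<le> y j" using y(3) that by (simp add: entries_bounded_by_degree_def)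
    ultimately show ?thesis using nonpos [of j] that by simp
  qed
  \<comment> \<open>With the tail zero, the first k entries sum to k times the degree; each is at
    most the degree, so all equal it.\<close>
  have "(\<Sum>j=1..k. deg y - y j) = 0"
    using root_degree_mult [OF k_pos k_less y(1)] sum_split [of y] tail by (simp add: sum_subtractf)
  moreover have le: "0 \<le> deg y - y j" if "j \<in> {1..k}" for j
    using y(3) that k_less by (simp add: entries_bounded_by_degree_def)
  ultimately have head: "y j = deg y" if "j \<in> {1..k}" for j
    using sum_nonneg_eq_0_iff [of "{1..k}" "\<lambda>j. deg y - y j"] that by simp
  have "y j = deg y * beta k j" for j
    using head [of j] tail [of j] y(1)
    by (cases "j \<in> {1..n}") (auto simp: beta_apply root_lattice_def int_vectors_def)
  moreover have "0 \<le> deg y"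
    using y(3) k_less unfolding entries_bounded_by_degree_def by force
  ultimately have "y = beta k" using multiple_of_beta [OF y(2)] by blast
  then show ?case using beta_real_root dec_lattice(4) [of x] 0 by (simp add: y_def)
next
  case (Suc m)
  define y where "y = reduction_step k n x"
  have shift: "(reduction_step k n ^^ Suc i) x = (reduction_step k n ^^ i) y" for i
    by (simp add: funpow_Suc_right y_def del: funpow.simps)
  have "y \<in> real_roots k n"
  proof (rule Suc.IH)
    show "y \<in> L" using Suc by (simp add: y_def reduction_step_in_lattice)
    show "int_form y = 2"
      using Suc dec_lattice [of x] by (simp add: y_def reduction_step_def int_form_refl_beta)
    show "\<forall>i\<le>m. entries_bounded_by_degree k n ((reduction_step k n ^^ i) y)"
      using Suc.prems(3) by (metis shift Suc_le_mono)
    show "\<forall>j\<in>{1..n}. (reduction_step k n ^^ (m + 1)) y j \<le> 0"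
      using Suc.prems(4) shift [of "m + 1"] by simp
  qed
  then show ?case using reduction_step_real_root Suc.prems by (simp add: y_def)
qed

text \<open>The bounds force a non-negative degree, and in degree 0 they force the zero vector,
  where q is 0.\<close>

lemma entries_bounded_degree_pos:
  assumes "x \<in> L" "int_form x = 2" "entries_bounded_by_degree k n x"
  shows "1 \<le> deg x"
proof (rule ccontr)
  assume "\<not> ?thesis"
  moreover have "0 \<le> deg x"
    using assms(3) k_less unfolding entries_bounded_by_degree_def by force
  ultimately have "deg x = 0" by simp
  moreover from this have "x i = 0" if "i \<in> {1..n}" for i
    using assms(3) that unfolding entries_bounded_by_degree_def by force
  ultimately have "int_form x = 0" by (simp add: int_form_def)
  then show False using assms(2) by simp
qed

end

theorem theorem1p1:
  fixes k n :: nat and x :: "nat \<Rightarrow> int"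
  assumes "1 \<le> k" and "k < n" and "x \<in> root_lattice k n"
  shows "x \<in> positive_real_roots k n \<and> 1 \<le> root_degree k n x \<longleftrightarrow>
    entries_bounded_by_degree k n x \<and>
    quad_form k n x = 2 \<and>
    (\<exists>m. (\<forall>i\<le>m. entries_bounded_by_degree k n ((reduction_step k n ^^ i) x)) \<and>
         (\<forall>j\<in>{1..n}. (reduction_step k n ^^ (m + 1)) x j \<le> 0))"
    (is "?root \<longleftrightarrow> ?bounded \<and> ?norm \<and> ?reduction")
proof -
  interpret J_diagram k n using assms by unfold_locales
  have norm: "?norm \<longleftrightarrow> int_form x = 2" using quad_form_eq_int_form [OF assms(3)] by simp
  show ?thesis
  proof
    assume ?root
    then have "x \<in> real_roots k n" "1 \<le> deg x" by (auto simp: positive_real_roots_def)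
    then show "?bounded \<and> ?norm \<and> ?reduction"
      using real_root_entries_bounded real_root_int_form real_root_reduction norm by blast
  next
    assume *: "?bounded \<and> ?norm \<and> ?reduction"
    then have "x \<in> real_roots k n" using reduction_imp_real_root assms norm by blast
    moreover have "1 \<le> deg x" using * entries_bounded_degree_pos assms norm by blast
    \<comment> \<open>The degree is the coefficient of \<beta>; being positive, it makes all
      coefficients non-negative.\<close>
    ultimately show ?root
      using real_root_nonneg [of x 0] k_less by (auto simp: positive_real_roots_def root_degree_def)
  qed
qed

end
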